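(* Consider either the exponential or the geometric model, with an admissible environment $(\mathbf{a},\mathbf{b})$ and an admissible parameter $z$, and let $I$, $J$ be the increments of the last-passage times $\widehat{G}$ with boundary weights. Let $k,l\in\mathbb{Z}_+$. Under $\mathbf{P}^z_{\mathbf{a},\mathbf{b}}$, (a) $I(i,l)$ has the same distribution as $W(i,0)$ for every $i\in\mathbb{N}$; (b) $J(k,j)$ has the same distribution as $W(0,j)$ for every $j\in\mathbb{N}$; (c) the random variables $\{I(i,l):i>k\}\cup\{J(k,j):j>l\}$ are (jointly) independent.
   Context: $\mathbb{N}=\{1,2,\dots\}$, $\mathbb{Z}_+=\{0,1,2,\dots\}$, $\mathbb{R}_+=[0,\infty)$; $x\vee y=\max\{x,y\}$. For a Borel measure $\eta$ on $\mathbb{R}$, $\underline{\eta}$ and $\overline{\eta}$ are the left and right endpoints of its support. Environment. $\mathbf{a}=(a_n)_{n\in\mathbb{N}}$ and $\mathbf{b}=(b_n)_{n\in\mathbb{N}}$ are values of stationary random sequences, in $(0,\infty)$ for the exponential model and in $(0,1)$ for the geometric model, whose joint distribution $\mu$ is ergodic under $\tau_k\times\tau_l$ for each $k,l\in\mathbb{N}$ ($\tau_k$ is the shift $(c_n)_{n}\mapsto(c_{n+k})_{n}$). $\alpha$ and $\beta$ are the distributions of $a_1$ and $b_1$ under $\mu$. Measures with boundary. $W(i,j)$, $i,j\in\mathbb{Z}_+$, are the coordinate projections on $\mathbb{R}_+^{\mathbb{Z}_+^2}$, and $\mathbf{P}^z_{\mathbf{a},\mathbf{b}}$ is the following product measure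 on $\mathbb{R}_+^{\mathbb{Z}_+^2}$ (so all $W(i,j)$ are independent). Exponential model: the admissible $(\mathbf{a},\mathbf{b})$ are those with $a_n\ge\underline{\alpha}$ and $b_n\ge\underline{\beta}$ for all $n\in\mathbb{N}$, and the admissible $z$ are $z\in(-\underline{\alpha},\underline{\beta})$ if $\underline{\alpha}+\underline{\beta}>0$, and $z=0$ if $\underline{\alpha}=\underline{\beta}=0$. For $i,j\in\mathbb{N}$, $x\ge0$: $\mathbf{P}^z_{\mathbf{a},\mathbf{b}}(W(i,j)\ge x)=e^{-(a_i+b_j)x}$, $\mathbf{P}^z_{\mathbf{a},\mathbf{b}}(W(0,0)=0)=1$, $\mathbf{P}^z_{\mathbf{a},\mathbf{b}}(W(i,0)\ge x)=e^{-(a_i+z)x}$, $\mathbf{P}^z_{\mathbf{a},\mathbf{b}}(W(0,j)\ge x)=e^{-(b_j-z)x}$. Geometric model: the admissible $(\mathbf{a},\mathbf{b})$ are those with $a_n\le\overline{\alpha}$ and $b_n\le\overline{\beta}$ for all $n\in\mathbb{N}$, and the admissible $z$ are $z\in(\overline{\alpha},1/\overline{\beta})$ if $\overline{\alpha}\,\overline{\beta}<1$, and $z=1$ if $\overline{\alpha}=\overline{\beta}=1$. The weights are $\mathbb{Z}_+$-valued and, for $i,j\in\mathbb{N}$, $k\in\mathbb{Z}_+$: $\mathbf{P}^z_{\mathbf{a},\mathbf{b}}(W(i,j)\ge k)=a_i^kb_j^k$, $\mathbf{P}^z_{\mathbf{a},\mathbf{b}}(W(0,0)=0)=1$, $\mathbf{P}^z_{\mathbf{a},\mathbf{b}}(W(i,0)\ge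 k)=a_i^k/z^k$, $\mathbf{P}^z_{\mathbf{a},\mathbf{b}}(W(0,j)\ge k)=b_j^kz^k$. Last-passage times with boundary. $\widehat{G}(0,0)=0$, $\widehat{G}(i,0)=\sum_{k=1}^iW(k,0)$, $\widehat{G}(0,j)=\sum_{k=1}^jW(0,k)$, and $\widehat{G}(i,j)=\widehat{G}(i-1,j)\vee\widehat{G}(i,j-1)+W(i,j)$ for $i,j\in\mathbb{N}$. Increments. $I(m,n)=\widehat{G}(m,n)-\widehat{G}(m-1,n)$ for $m\ge1,n\ge0$, and $J(m,n)=\widehat{G}(m,n)-\widehat{G}(m,n-1)$ for $m\ge0,n\ge1$. *)

theory Defs
  imports "HOL-Probability.Probability"
begin

section \<open>Environment\<close>

datatype model = Exponential | Geometric

fun param_range :: "model \<Rightarrow> real set" where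
  "param_range Exponential = {0<..}"
| "param_range Geometric = {0<..<1}"

text \<open>Sequences are indexed by \<open>{1, 2, \<dots>}\<close>; the value at index \<open>0\<close> carries no information.\<close>

definition seq_space :: "model \<Rightarrow> (nat \<Rightarrow> real) measure" where
  "seq_space M = (\<Pi>\<^sub>M n\<in>{1..}. restrict_space borel (param_range M))"

definition shift :: "nat \<Rightarrow> (nat \<Rightarrow> real) \<Rightarrow> nat \<Rightarrow> real" where
  "shift k c = (\<lambda>n\<in>{1..}. c (n + k))"

definition ergodic :: "'a measure \<Rightarrow> ('a \<Rightarrow> 'a) \<Rightarrow> bool" where
  "ergodic N T \<longleftrightarrow> prob_space N \<and> T \<in> measurable N N \<and> distr N N T = N \<and>
     (\<forall>A\<in>sets N. T -` A \<inter> space N = A \<longrightarrow> measure N A \<in> {0, 1})"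

text \<open>Stationarity of the two sequences is the measure-preservation part of ergodicity.\<close>

definition environment_law :: "model \<Rightarrow> ((nat \<Rightarrow> real) \<times> (nat \<Rightarrow> real)) measure \<Rightarrow> bool" where
  "environment_law M \<mu> \<longleftrightarrow>
     sets \<mu> = sets (seq_space M \<Otimes>\<^sub>M seq_space M) \<and> prob_space \<mu> \<and>
     (\<forall>k\<ge>1. \<forall>l\<ge>1. ergodic \<mu> (map_prod (shift k) (shift l)))"

definition alpha_law :: "((nat \<Rightarrow> real) \<times> (nat \<Rightarrow> real)) measure \<Rightarrow> real measure" where
  "alpha_law \<mu> = distr \<mu> borel (\<lambda>(a, b). a 1)"

definition beta_law :: "((nat \<Rightarrow> real) \<times> (nat \<Rightarrow> real)) measure \<Rightarrow> real measure" where
  "beta_law \<mu> = distr \<mu> borel (\<lambda>(a, b). b 1)"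

definition measure_support :: "real measure \<Rightarrow> real set" where
  "measure_support \<eta> = {x. \<forall>U. open U \<longrightarrow> x \<in> U \<longrightarrow> emeasure \<eta> U > 0}"

text \<open>Real-valued endpoints; only meaningful when the (nonempty) support is bounded on the
  relevant side.  Below, the left endpoint is only taken of laws on \<open>(0, \<infinity>)\<close> and the right
  endpoint only of laws on \<open>(0, 1)\<close>.\<close>

definition left_endpoint :: "real measure \<Rightarrow> real" where
  "left_endpoint \<eta> = Inf (measure_support \<eta>)"

definition right_endpoint :: "real measure \<Rightarrow> real" where
  "right_endpoint \<eta> = Sup (measure_support \<eta>)"

fun admissible_env ::
  "model \<Rightarrow> ((nat \<Rightarrow> real) \<times> (nat \<Rightarrow> real)) measure \<Rightarrow> (nat \<Rightarrow> real) \<Rightarrow> (nat \<Rightarrow> real) \<Rightarrow> bool" where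
  "admissible_env Exponential \<mu> a b \<longleftrightarrow>
     (\<forall>n\<ge>1. a n \<in> param_range Exponential \<and> b n \<in> param_range Exponential \<and>
       a n \<ge> left_endpoint (alpha_law \<mu>) \<and> b n \<ge> left_endpoint (beta_law \<mu>))"
| "admissible_env Geometric \<mu> a b \<longleftrightarrow>
     (\<forall>n\<ge>1. a n \<in> param_range Geometric \<and> b n \<in> param_range Geometric \<and>
       a n \<le> right_endpoint (alpha_law \<mu>) \<and> b n \<le> right_endpoint (beta_law \<mu>))"

fun admissible_z :: "model \<Rightarrow> ((nat \<Rightarrow> real) \<times> (nat \<Rightarrow> real)) measure \<Rightarrow> real \<Rightarrow> bool" where
  "admissible_z Exponential \<mu> z \<longleftrightarrow>
     (let \<alpha> = left_endpoint (alpha_law \<mu>); \<beta> = left_endpoint (beta_law \<mu>)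
      in \<alpha> + \<beta> > 0 \<and> z \<in> {-\<alpha><..<\<beta>} \<or> \<alpha> = 0 \<and> \<beta> = 0 \<and> z = 0)"
| "admissible_z Geometric \<mu> z \<longleftrightarrow>
     (let \<alpha> = right_endpoint (alpha_law \<mu>); \<beta> = right_endpoint (beta_law \<mu>)
      in \<alpha> * \<beta> < 1 \<and> z \<in> {\<alpha><..<1 / \<beta>} \<or> \<alpha> = 1 \<and> \<beta> = 1 \<and> z = 1)"


section \<open>Measures with boundary\<close>

definition exp_law :: "real \<Rightarrow> real measure" where
  "exp_law r = density lborel (exponential_density r)"

text \<open>The parameter is the ratio \<open>q\<close> of the tail probabilities \<open>q ^ k\<close>, whereas the argument of
  \<^const>\<open>geometric_pmf\<close> is the success probability.\<close>

definition geom_law :: "real \<Rightarrow> real measure" where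
  "geom_law q = distr (measure_pmf (geometric_pmf (1 - q))) borel real"

fun weight_law ::
  "model \<Rightarrow> (nat \<Rightarrow> real) \<Rightarrow> (nat \<Rightarrow> real) \<Rightarrow> real \<Rightarrow> nat \<times> nat \<Rightarrow> real measure" where
  "weight_law Exponential a b z (i, j) =
     (if i = 0 \<and> j = 0 then return borel 0
      else if j = 0 then exp_law (a i + z)
      else if i = 0 then exp_law (b j - z)
      else exp_law (a i + b j))"
| "weight_law Geometric a b z (i, j) =
     (if i = 0 \<and> j = 0 then return borel 0
      else if j = 0 then geom_law (a i / z)
      else if i = 0 then geom_law (b j * z)
      else geom_law (a i * b j))"

definition boundary_measure ::
  "model \<Rightarrow> (nat \<Rightarrow> real) \<Rightarrow> (nat \<Rightarrow> real) \<Rightarrow> real \<Rightarrow> (nat \<times> nat \<Rightarrow> real) measure" where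
  "boundary_measure M a b z = (\<Pi>\<^sub>M p\<in>UNIV. restrict_space (weight_law M a b z p) {0..})"

definition weight :: "nat \<Rightarrow> nat \<Rightarrow> (nat \<times> nat \<Rightarrow> real) \<Rightarrow> real" where
  "weight i j \<omega> = \<omega> (i, j)"


section \<open>Last-passage times with boundary and their increments\<close>

fun Ghat :: "(nat \<times> nat \<Rightarrow> real) \<Rightarrow> nat \<Rightarrow> nat \<Rightarrow> real" where
  "Ghat \<omega> 0 0 = 0"
| "Ghat \<omega> (Suc i) 0 = (\<Sum>k=1..Suc i. weight k 0 \<omega>)"
| "Ghat \<omega> 0 (Suc j) = (\<Sum>k=1..Suc j. weight 0 k \<omega>)"
| "Ghat \<omega> (Suc i) (Suc j) =
     max (Ghat \<omega> i (Suc j)) (Ghat \<omega> (Suc i) j) + weight (Suc i) (Suc j) \<omega>"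

text \<open>\<open>incI m n\<close> is only meaningful for \<open>m \<ge> 1\<close>, and \<open>incJ m n\<close> for \<open>n \<ge> 1\<close>.\<close>

definition incI :: "nat \<Rightarrow> nat \<Rightarrow> (nat \<times> nat \<Rightarrow> real) \<Rightarrow> real" where
  "incI m n \<omega> = Ghat \<omega> m n - Ghat \<omega> (m - 1) n"

definition incJ :: "nat \<Rightarrow> nat \<Rightarrow> (nat \<times> nat \<Rightarrow> real) \<Rightarrow> real" where
  "incJ m n \<omega> = Ghat \<omega> m n - Ghat \<omega> m (n - 1)"


section \<open>The weights have the prescribed tails\<close>

lemma exp_law_tail:
  assumes "r > 0" "x \<ge> 0"
  shows "prob_space (exp_law r)" "measure (exp_law r) {x..} = exp (- r * x)"
proof -
  interpret prob_space "exp_law r"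
    unfolding exp_law_def by (rule prob_space_exponential_density[OF assms(1)])
  show "prob_space (exp_law r)" by (rule prob_space_axioms)
  have D: "distributed (exp_law r) lborel (\<lambda>x. x) (exponential_density r)"
    unfolding distributed_def exp_law_def
    by (auto simp: measurable_ident_sets intro!: distr_id2)
  have S: "sets (exp_law r) = sets borel" "space (exp_law r) = UNIV"
    by (simp_all add: exp_law_def)
  have "AE y in exp_law r. y \<noteq> x"
    unfolding exp_law_def using AE_lborel_singleton[of x]
    by (subst AE_density) auto
  then have "measure (exp_law r) {x..} = measure (exp_law r) {x<..}"
    by (intro measure_eq_AE) (auto simp: S elim!: eventually_mono)
  also have "\<dots> = exp (- x * r)"
    using exponential_distributedD_gt[OF D assms(2) assms(1)]
    by (simp add: S greaterThan_def)
  finally show "measure (exp_law r) {x..} = exp (- r * x)"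
    by (simp add: mult.commute)
qed

lemma geom_law_tail:
  assumes "0 < q" "q < 1"
  shows "prob_space (geom_law q)" "measure (geom_law q) {real k..} = q ^ k"
proof -
  show P: "prob_space (geom_law q)"
    unfolding geom_law_def by (rule measure_pmf.prob_space_distr) simp
  have *: "measure_pmf.prob (geometric_pmf (1 - q)) {..<k} = 1 - q ^ k"
    using assms
    by (subst measure_measure_pmf_finite)
       (auto simp: sum_distrib_right[symmetric] one_diff_power_eq[of q] sum_distrib_left mult_ac)
  have "measure (geom_law q) {real k..} = measure_pmf.prob (geometric_pmf (1 - q)) {k..}"
    unfolding geom_law_def by (subst measure_distr) (auto intro!: arg_cong[where f = "measure _"])
  also have "{k..} = UNIV - {..<k}" by auto
  also have "measure_pmf.prob (geometric_pmf (1 - q)) (UNIV - {..<k}) = q ^ k"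
    using measure_pmf.prob_compl[of "{..<k}" "geometric_pmf (1 - q)"] * by simp
  finally show "measure (geom_law q) {real k..} = q ^ k" .
qed

lemma admissible_exponential:
  assumes "admissible_env Exponential \<mu> a b" "admissible_z Exponential \<mu> z" "i \<ge> 1" "j \<ge> 1"
  shows "a i + b j > 0" "a i + z > 0" "b j - z > 0"
proof -
  have "a i > 0" "b j > 0" "a i \<ge> left_endpoint (alpha_law \<mu>)" "b j \<ge> left_endpoint (beta_law \<mu>)"
    using assms(1,3,4) by auto
  with assms(2) show "a i + b j > 0" "a i + z > 0" "b j - z > 0"
    by (auto simp: Let_def)
qed

lemma admissible_geometric:
  assumes "admissible_env Geometric \<mu> a b" "admissible_z Geometric \<mu> z" "i \<ge> 1" "j \<ge> 1"
  shows "a i * b j \<in> {0<..<1}" "a i / z \<in> {0<..<1}" "b j * z \<in> {0<..<1}" "z > 0"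
proof -
  have *: "0 < a i" "a i < 1" "0 < b j" "b j < 1"
    "a i \<le> right_endpoint (alpha_law \<mu>)" "b j \<le> right_endpoint (beta_law \<mu>)"
    using assms(1,3,4) by auto
  then have "0 < right_endpoint (beta_law \<mu>)" by linarith
  with * assms(2) have z: "0 < z" "a i < z" "right_endpoint (beta_law \<mu>) * z < 1 \<or> z = 1"
    by (auto simp: Let_def field_simps)
  have "b j * z \<le> right_endpoint (beta_law \<mu>) * z"
    using *(6) z(1) by (intro mult_right_mono) auto
  then have bz: "b j * z < 1" using z(3) *(4) by (elim disjE) auto
  show "a i * b j \<in> {0<..<1}" using * mult_strict_mono[of "a i" 1 "b j" 1] by auto
  show "a i / z \<in> {0<..<1}" "b j * z \<in> {0<..<1}" "z > 0"
    using * z bz by (auto simp: field_simps)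
qed

lemma weight_law_prob:
  assumes "admissible_env M \<mu> a b" "admissible_z M \<mu> z"
  shows "prob_space (weight_law M a b z p)" "measure (weight_law M a b z p) {0..} = 1"
    "sets (weight_law M a b z p) = sets borel"
proof -
  obtain i j where p: "p = (i, j)" by fastforce
  have e: "prob_space (exp_law r) \<and> measure (exp_law r) {0..} = 1" if "r > 0" for r
    using exp_law_tail[OF that, of 0] by simp
  have g: "prob_space (geom_law q) \<and> measure (geom_law q) {0..} = 1" if "q \<in> {0<..<1}" for q
    using geom_law_tail(1)[of q] geom_law_tail(2)[of q 0] that by simp
  have r: "prob_space (return borel (0::real)) \<and> measure (return borel (0::real)) {0..} = 1"
    by (simp add: prob_space_return measure_return)
  have "prob_space (weight_law M a b z p) \<and> measure (weight_law M a b z p) {0..} = 1"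
  proof (cases M)
    case Exponential
    note adm = admissible_exponential[OF assms[unfolded Exponential]]
    have "i \<ge> 1 \<Longrightarrow> j \<ge> 1 \<Longrightarrow> a i + b j > 0" "i \<ge> 1 \<Longrightarrow> a i + z > 0" "j \<ge> 1 \<Longrightarrow> b j - z > 0"
      using adm(1) adm(2)[of i 1] adm(3)[of 1 j] by auto
    then show ?thesis using r e by (auto simp: Exponential p)
  next
    case Geometric
    note adm = admissible_geometric[OF assms[unfolded Geometric]]
    have "i \<ge> 1 \<Longrightarrow> j \<ge> 1 \<Longrightarrow> a i * b j \<in> {0<..<1}"
      "i \<ge> 1 \<Longrightarrow> a i / z \<in> {0<..<1}" "j \<ge> 1 \<Longrightarrow> b j * z \<in> {0<..<1}"
      using adm(1) adm(2)[of i 1] adm(3)[of 1 j] by auto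
    then show ?thesis using r g by (auto simp del: greaterThanLessThan_iff simp: Geometric p)
  qed
  then show "prob_space (weight_law M a b z p)" "measure (weight_law M a b z p) {0..} = 1"
    by auto
  show "sets (weight_law M a b z p) = sets borel"
    by (cases M) (auto simp: p exp_law_def geom_law_def)
qed

lemma prob_space_restrict_weight_law:
  assumes "admissible_env M \<mu> a b" "admissible_z M \<mu> z"
  shows "prob_space (restrict_space (weight_law M a b z p) {0..})"
proof -
  interpret prob_space "weight_law M a b z p" by (rule weight_law_prob(1)[OF assms])
  show ?thesis
    using weight_law_prob(2,3)[OF assms, of p]
    by (intro prob_space_restrict_space) (auto simp: emeasure_eq_measure)
qed

lemma prob_space_boundary_measure:
  assumes "admissible_env M \<mu> a b" "admissible_z M \<mu> z"
  shows "prob_space (boundary_measure M a b z)"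
  unfolding boundary_measure_def
  by (intro prob_space_PiM prob_space_restrict_weight_law[OF assms])

lemma weight_tail:
  assumes "admissible_env M \<mu> a b" "admissible_z M \<mu> z" "x \<ge> 0"
  shows "measure (boundary_measure M a b z)
           {\<omega> \<in> space (boundary_measure M a b z). weight i j \<omega> \<ge> x}
         = measure (weight_law M a b z (i, j)) {x..}"
proof -
  let ?L = "\<lambda>p. restrict_space (weight_law M a b z p) {0..}"
  interpret product_prob_space ?L UNIV
    by (intro product_prob_spaceI prob_space_restrict_weight_law[OF assms(1,2)])
  have S: "sets (weight_law M a b z p) = sets borel" for p
    by (rule weight_law_prob(3)[OF assms(1,2)])
  have sp: "space (weight_law M a b z p) = UNIV" for p
    using sets_eq_imp_space_eq[OF S] by simp
  have X: "{x..} \<in> sets (?L (i, j))"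
    using assms(3) by (subst sets_restrict_space_iff) (auto simp: S)
  have "measure (boundary_measure M a b z)
          {\<omega> \<in> space (boundary_measure M a b z). weight i j \<omega> \<ge> x} = measure (?L (i, j)) {x..}"
    using emeasure_PiM_Collect_single[OF _ X] by (simp add: boundary_measure_def weight_def measure_def)
  also have "\<dots> = measure (weight_law M a b z (i, j)) {x..}"
    using assms(3) by (intro measure_restrict_space) (auto simp: S sp)
  finally show ?thesis .
qed

lemma weight_tail_exponential:
  assumes "admissible_env Exponential \<mu> a b" "admissible_z Exponential \<mu> z"
    and "i \<ge> 1" "j \<ge> 1" "x \<ge> 0"
  defines "P \<equiv> boundary_measure Exponential a b z"
  shows "measure P {\<omega> \<in> space P. weight i j \<omega> \<ge> x} = exp (- (a i + b j) * x)"
    and "measure P {\<omega> \<in> space P. weight i 0 \<omega> \<ge> x} = exp (- (a i + z) * x)"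
    and "measure P {\<omega> \<in> space P. weight 0 j \<omega> \<ge> x} = exp (- (b j - z) * x)"
  using assms(3) assms(4) exp_law_tail(2)[OF _ assms(5)] admissible_exponential[OF assms(1-4)]
  unfolding P_def weight_tail[OF assms(1,2,5)] by (simp_all add: algebra_simps)

lemma weight_tail_geometric:
  assumes "admissible_env Geometric \<mu> a b" "admissible_z Geometric \<mu> z" "i \<ge> 1" "j \<ge> 1"
  defines "P \<equiv> boundary_measure Geometric a b z"
  shows "measure P {\<omega> \<in> space P. weight i j \<omega> \<ge> real k} = a i ^ k * b j ^ k"
    and "measure P {\<omega> \<in> space P. weight i 0 \<omega> \<ge> real k} = a i ^ k / z ^ k"
    and "measure P {\<omega> \<in> space P. weight 0 j \<omega> \<ge> real k} = b j ^ k * z ^ k"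
  using assms(3,4) geom_law_tail(2)[of _ k] admissible_geometric[OF assms(1-4)]
  unfolding P_def weight_tail[OF assms(1,2) of_nat_0_le_iff]
  by (simp_all add: power_mult_distrib power_divide)

end

theory Submission
  imports Defs
begin

text \<open>The increments satisfy a local recursion.  With \<open>X = I(m, n - 1)\<close>, \<open>Y = J(m - 1, n)\<close> and
  \<open>W = W(m, n)\<close>,
  \<open>I(m, n) = max (X - Y) 0 + W\<close> and \<open>J(m, n) = max (Y - X) 0 + W\<close>.  If \<open>X\<close>, \<open>Y\<close>, \<open>W\<close> are independent
  with the laws of \<open>W(m, 0)\<close>, \<open>W(0, n)\<close>, \<open>W(m, n)\<close>, then the new pair has the same joint law as
  \<open>(X, Y)\<close>.  The reason is the lack of memory, shared by both models: conditioning on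
  \<open>min X Y \<ge> s\<close> does not affect \<open>X - Y\<close>, so the minimum is independent of the difference, and its law is
  that of \<open>W\<close> because \<open>(a m + z) + (b n - z) = a m + b n\<close>, respectively
  \<open>(a m / z) * (b n * z) = a m * b n\<close>.  Since \<open>X = max (X - Y) 0 + min X Y\<close> and
  \<open>Y = max (Y - X) 0 + min X Y\<close>, replacing the minimum by \<open>W\<close> changes nothing in law
  (\<open>distr_diff_min\<close>, \<open>distr_corner_flip\<close>).

  It follows by adding cells one at a time that, for each finite Young diagram, the increments along
  its boundary path together with the weights outside the diagram are independent, with the laws of
  the boundary weights in the corresponding columns and rows (\<open>interface_law\<close>).  The increments in the
  theorem lie along the path down column \<open>k\<close> to \<open>(k, l)\<close> and then along row \<open>l\<close>.  Independence concerns finitely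
  many of them at a time, and these lie on the boundary of a truncated, finite diagram.\<close>

section \<open>Corner flips of memoryless laws\<close>

text \<open>Conditionally on exceeding \<open>s\<close>, an event of probability \<open>c\<close>, the residual after time \<open>d\<close> is again
  distributed as \<open>\<mu>\<close>.  The threshold \<open>s\<close> and the time \<open>d\<close> are kept apart so that every real \<open>s\<close> is
  covered: an exponential variable exceeds a negative \<open>s\<close> for free (then \<open>d = 0\<close>), and a geometric
  variable exceeds \<open>s\<close> exactly when it reaches the next integer (then \<open>d = \<lceil>s\<rceil>\<close>, or \<open>0\<close> if
  \<open>s < 0\<close>).\<close>

definition memoryless_at :: "real measure \<Rightarrow> real \<Rightarrow> real \<Rightarrow> ennreal \<Rightarrow> bool" where
  "memoryless_at \<mu> s d c \<longleftrightarrow>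
     (\<forall>f\<in>borel_measurable borel.
        (\<integral>\<^sup>+x. indicator {s..} x * f (x - d) \<partial>\<mu>) = c * (\<integral>\<^sup>+x. f x \<partial>\<mu>))"

lemma memoryless_atD:
  assumes "memoryless_at \<mu> s d c" "f \<in> borel_measurable borel"
  shows "(\<integral>\<^sup>+x. indicator {s..} x * f (x - d) \<partial>\<mu>) = c * (\<integral>\<^sup>+x. f x \<partial>\<mu>)"
  using assms by (simp add: memoryless_at_def)

lemma memoryless_at_tail:
  assumes "memoryless_at \<mu> s d c" "prob_space \<mu>" "sets \<mu> = sets borel"
  shows "emeasure \<mu> {s..} = c"
proof -
  interpret prob_space \<mu> by fact
  have "(\<integral>\<^sup>+x. indicator {s..} x * 1 \<partial>\<mu>) = c * (\<integral>\<^sup>+x. 1 \<partial>\<mu>)"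
    using assms(1) by (auto simp: memoryless_at_def dest!: bspec[where x = "\<lambda>_. 1"])
  then show ?thesis using assms(3) by (simp add: emeasure_space_1)
qed

lemma memoryless_at_exp_law:
  assumes "r > 0"
  shows "memoryless_at (exp_law r) s (max s 0) (ennreal (exp (- r * max s 0)))"
  unfolding memoryless_at_def
proof
  fix f :: "real \<Rightarrow> ennreal" assume [measurable]: "f \<in> borel_measurable borel"
  let ?d = "max s 0"
  have "(\<integral>\<^sup>+x. indicator {s..} x * f (x - ?d) \<partial>exp_law r) =
      (\<integral>\<^sup>+x. ennreal (exponential_density r x) * (indicator {s..} x * f (x - ?d)) \<partial>lborel)"
    unfolding exp_law_def by (subst nn_integral_density) auto
  also have "\<dots> = (\<integral>\<^sup>+x. ennreal (exponential_density r (?d + x)) *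
      (indicator {s..} (?d + x) * f x) \<partial>lborel)"
    by (subst nn_integral_real_affine[where c = 1 and t = ?d]) auto
  also have "\<dots> = (\<integral>\<^sup>+x. ennreal (exp (- r * ?d)) * (ennreal (exponential_density r x) * f x) \<partial>lborel)"
  proof (rule nn_integral_cong)
    fix x
    show "ennreal (exponential_density r (?d + x)) * (indicator {s..} (?d + x) * f x) =
      ennreal (exp (- r * ?d)) * (ennreal (exponential_density r x) * f x)"
    proof (cases "x < 0")
      case True
      then have "exponential_density r x = 0" 
        "exponential_density r (?d + x) = 0 \<or> indicator {s..} (?d + x) = (0::ennreal)"
        by (auto simp: exponential_density_def)
      then show ?thesis by auto
    next
      case False
      then have "indicator {s..} (?d + x) = (1::ennreal)" by auto
      moreover have "exponential_density r (?d + x) = exp (- r * ?d) * exponential_density r x"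
        using False by (auto simp: exponential_density_def exp_add[symmetric] algebra_simps)
      moreover have "exponential_density r x \<ge> 0"
        using assms False by (auto simp: exponential_density_def)
      ultimately show ?thesis by (simp add: ennreal_mult mult_ac)
    qed
  qed
  also have "\<dots> = ennreal (exp (- r * ?d)) * (\<integral>\<^sup>+x. f x \<partial>exp_law r)"
    unfolding exp_law_def by (subst nn_integral_cmult) (auto simp: nn_integral_density)
  finally show "(\<integral>\<^sup>+x. indicator {s..} x * f (x - ?d) \<partial>exp_law r) =
    ennreal (exp (- r * ?d)) * (\<integral>\<^sup>+x. f x \<partial>exp_law r)" .
qed

lemma memoryless_at_geom_law:
  assumes "0 < q" "q < 1"
  shows "memoryless_at (geom_law q) s (real (nat \<lceil>s\<rceil>)) (ennreal (q ^ nat \<lceil>s\<rceil>))"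
  unfolding memoryless_at_def
proof
  fix f :: "real \<Rightarrow> ennreal" assume [measurable]: "f \<in> borel_measurable borel"
  let ?k = "nat \<lceil>s\<rceil>"
  have nn: "(\<integral>\<^sup>+x. g x \<partial>geom_law q) = (\<integral>\<^sup>+n. ennreal (q ^ n * (1 - q)) * g (real n) \<partial>count_space UNIV)"
    if [measurable]: "g \<in> borel_measurable borel" for g
    unfolding geom_law_def using assms
    by (subst nn_integral_distr) (auto simp: nn_integral_measure_pmf)
  have ind: "indicator {s..} (real n) = (indicator {?k..} n :: ennreal)" for n
    by (auto simp: indicator_def)
  have "(\<integral>\<^sup>+x. indicator {s..} x * f (x - real ?k) \<partial>geom_law q) =
      (\<integral>\<^sup>+n. ennreal (q ^ n * (1 - q)) * f (real n - real ?k) * indicator {?k..} n \<partial>count_space UNIV)"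
    by (subst nn) (auto simp: ind mult_ac)
  also have "\<dots> = (\<integral>\<^sup>+n. ennreal (q ^ n * (1 - q)) * f (real n - real ?k) \<partial>count_space {?k..})"
    by (simp add: nn_integral_count_space_indicator)
  also have "\<dots> = (\<integral>\<^sup>+n. ennreal (q ^ (?k + n) * (1 - q)) * f (real (?k + n) - real ?k) \<partial>count_space UNIV)"
    by (rule nn_integral_bij_count_space[symmetric, where g = "\<lambda>n. ?k + n"])
       (rule bij_betwI[where g = "\<lambda>n. n - ?k"]; auto)
  also have "\<dots> = (\<integral>\<^sup>+n. ennreal (q ^ ?k) * (ennreal (q ^ n * (1 - q)) * f (real n)) \<partial>count_space UNIV)"
    using assms by (intro nn_integral_cong) (simp add: power_add ennreal_mult mult_ac)
  also have "\<dots> = ennreal (q ^ ?k) * (\<integral>\<^sup>+x. f x \<partial>geom_law q)"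
    by (subst nn_integral_cmult) (auto simp: nn)
  finally show "(\<integral>\<^sup>+x. indicator {s..} x * f (x - real ?k) \<partial>geom_law q) =
    ennreal (q ^ ?k) * (\<integral>\<^sup>+x. f x \<partial>geom_law q)" .
qed

lemma measure_eqI_atLeast:
  fixes M N :: "real measure"
  assumes "sets M = sets borel" "sets N = sets borel" "finite_measure M"
    and "\<And>s. emeasure M {s..} = emeasure N {s..}"
  shows "M = N"
proof (rule measure_eqI_generator_eq[where E = "range atLeast" and \<Omega> = UNIV and A = "\<lambda>n. {- real n..}"])
  interpret finite_measure M by fact
  show "emeasure M {- real i..} \<noteq> \<infinity>" for i by simp
  have "{x..} \<inter> {y..} = {max x y..}" for x y :: real by auto
  then show "Int_stable (range (atLeast :: real \<Rightarrow> real set))"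
    by (auto simp: Int_stable_def)
  show "sets M = sigma_sets UNIV (range atLeast)" "sets N = sigma_sets UNIV (range atLeast)"
    using assms(1,2) by (simp_all add: borel_Ici)
  show "(\<Union>i. {- real i..}) = UNIV"
    by (auto intro: real_arch_simple simp: minus_le_iff)
qed (use assms(4) in auto)

text \<open>For independent \<open>X\<close> and \<open>Y\<close> that are memoryless with the same residual time \<open>d\<close>, conditioning on
  \<open>min X Y \<ge> s\<close>, that is, on \<open>X \<ge> s\<close> and \<open>Y \<ge> s\<close>, leaves the law of
  \<open>X - Y = (X - d) - (Y - d)\<close> unchanged.  So \<open>X - Y\<close> is independent of \<open>min X Y\<close>, and the tails
  of \<open>min X Y\<close> are those of \<open>\<rho>\<close>.\<close>

lemma distr_diff_min:
  assumes P: "prob_space \<mu>" "prob_space \<nu>" "prob_space \<rho>"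
    and S: "sets \<mu> = sets borel" "sets \<nu> = sets borel" "sets \<rho> = sets borel"
    and ml: "\<And>s. \<exists>d c c'. memoryless_at \<mu> s d c \<and> memoryless_at \<nu> s d c' \<and> emeasure \<rho> {s..} = c * c'"
  shows "distr (\<mu> \<Otimes>\<^sub>M \<nu>) borel (\<lambda>(x, y). x - y) \<Otimes>\<^sub>M \<rho> =
    distr (\<mu> \<Otimes>\<^sub>M \<nu>) (borel \<Otimes>\<^sub>M borel) (\<lambda>(x, y). (x - y, min x y))"
proof -
  interpret \<mu>: prob_space \<mu> by fact
  interpret \<nu>: prob_space \<nu> by fact
  interpret \<rho>: prob_space \<rho> by fact
  interpret PP: pair_prob_space \<mu> \<nu> ..
  note [measurable_cong] = S
  define Q where "Q = \<mu> \<Otimes>\<^sub>M \<nu>"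
  have [measurable_cong]: "sets Q = sets (borel \<Otimes>\<^sub>M borel)"
    unfolding Q_def by (intro sets_pair_measure_cong S)
  have spQ: "space Q = UNIV"
    using S[THEN sets_eq_imp_space_eq] by (simp add: Q_def space_pair_measure)
  interpret Q: prob_space Q unfolding Q_def by (rule PP.prob_space_axioms)
  define D where "D = (\<lambda>(x::real, y::real). x - y)"
  define m where "m = (\<lambda>(x::real, y::real). min x y)"
  have [measurable]: "D \<in> borel_measurable Q" "m \<in> borel_measurable Q"
    unfolding D_def m_def by measurable
  interpret DQ: prob_space "distr Q borel D" by (rule Q.prob_space_distr) simp
  have "distr Q borel D \<Otimes>\<^sub>M \<rho> = distr Q (borel \<Otimes>\<^sub>M borel) (\<lambda>z. (D z, m z))"
  proof (rule pair_measure_eqI)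
    fix B A assume "B \<in> sets (distr Q borel D)" and A: "A \<in> sets \<rho>"
    then have [measurable]: "B \<in> sets borel" "A \<in> sets borel" using S by auto
    \<comment> \<open>With \<open>B\<close> fixed, both sides are finite measures in \<open>A\<close>, so comparing them on half-lines suffices.\<close>
    let ?N = "distr (density Q (\<lambda>z. indicator B (D z))) borel m"
    have "scale_measure (emeasure (distr Q borel D) B) \<rho> = ?N"
    proof (rule measure_eqI_atLeast)
      show "finite_measure (scale_measure (emeasure (distr Q borel D) B) \<rho>)"
        by (intro finite_measureI) (simp add: ennreal_mult_eq_top_iff)
      fix s
      obtain d c c' where *: "memoryless_at \<mu> s d c" "memoryless_at \<nu> s d c'" "emeasure \<rho> {s..} = c * c'"
        using ml by blast
      have "emeasure ?N {s..} = (\<integral>\<^sup>+z. indicator B (D z) * indicator {s..} (m z) \<partial>Q)"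
        by (simp add: nn_integral_distr nn_integral_density flip: nn_integral_indicator)
      also have "\<dots> = (\<integral>\<^sup>+x. \<integral>\<^sup>+y. indicator B (D (x, y)) * indicator {s..} (m (x, y)) \<partial>\<nu> \<partial>\<mu>)"
        unfolding Q_def by (subst \<nu>.nn_integral_fst[symmetric]) (auto simp: D_def m_def)
      \<comment> \<open>The common shift by \<open>d\<close> cancels in the difference.\<close>
      also have "\<dots> = (\<integral>\<^sup>+x. \<integral>\<^sup>+y. indicator {s..} x *
          (indicator {s..} y * indicator B ((x - d) - (y - d))) \<partial>\<nu> \<partial>\<mu>)"
        by (intro nn_integral_cong) (auto simp: D_def m_def split: split_indicator)
      also have "\<dots> = (\<integral>\<^sup>+x. indicator {s..} x *
          (\<integral>\<^sup>+y. indicator {s..} y * indicator B ((x - d) - (y - d)) \<partial>\<nu>) \<partial>\<mu>)"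
        by (intro nn_integral_cong nn_integral_cmult) auto
      also have "\<dots> = (\<integral>\<^sup>+x. indicator {s..} x * (c' * (\<integral>\<^sup>+y. indicator B ((x - d) - y) \<partial>\<nu>)) \<partial>\<mu>)"
      proof (intro nn_integral_cong arg_cong2[where f = "(*)"] refl)
        fix x
        have "(\<lambda>y. indicator B ((x - d) - y) :: ennreal) \<in> borel_measurable borel"
          by measurable
        then show "(\<integral>\<^sup>+y. indicator {s..} y * indicator B ((x - d) - (y - d)) \<partial>\<nu>) =
            c' * (\<integral>\<^sup>+y. indicator B ((x - d) - y) \<partial>\<nu>)"
          by (rule memoryless_atD[OF *(2)])
      qed
      also have "\<dots> = c * (\<integral>\<^sup>+x. c' * (\<integral>\<^sup>+y. indicator B (x - y) \<partial>\<nu>) \<partial>\<mu>)"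
      proof -
        have "(\<lambda>x. c' * (\<integral>\<^sup>+y. indicator B (x - y) \<partial>\<nu>)) \<in> borel_measurable borel"
          by measurable
        then show ?thesis by (rule memoryless_atD[OF *(1)])
      qed
      also have "\<dots> = c * c' * (\<integral>\<^sup>+x. \<integral>\<^sup>+y. indicator B (x - y) \<partial>\<nu> \<partial>\<mu>)"
        by (subst nn_integral_cmult) (auto simp: mult_ac)
      also have "(\<integral>\<^sup>+x. \<integral>\<^sup>+y. indicator B (x - y) \<partial>\<nu> \<partial>\<mu>) = (\<integral>\<^sup>+z. indicator B (D z) \<partial>Q)"
        unfolding Q_def by (subst \<nu>.nn_integral_fst[symmetric]) (auto simp: D_def)
      also have "\<dots> = emeasure (distr Q borel D) B"
        by (simp flip: nn_integral_indicator add: nn_integral_distr)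
      finally show "emeasure (scale_measure (emeasure (distr Q borel D) B) \<rho>) {s..} = emeasure ?N {s..}"
        using *(3) S by (simp add: mult_ac)
    qed (use S in simp_all)
    then have "emeasure (scale_measure (emeasure (distr Q borel D) B) \<rho>) A = emeasure ?N A" by simp
    also have "emeasure ?N A = emeasure (distr Q (borel \<Otimes>\<^sub>M borel) (\<lambda>z. (D z, m z))) (B \<times> A)"
    proof -
      have "emeasure ?N A = (\<integral>\<^sup>+z. indicator B (D z) * indicator A (m z) \<partial>Q)"
        by (simp add: nn_integral_distr nn_integral_density flip: nn_integral_indicator)
      also have "\<dots> = (\<integral>\<^sup>+z. indicator (B \<times> A) (D z, m z) \<partial>Q)"
        by (intro nn_integral_cong) (auto split: split_indicator)
      also have "\<dots> = emeasure (distr Q (borel \<Otimes>\<^sub>M borel) (\<lambda>z. (D z, m z))) (B \<times> A)"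
        by (simp add: nn_integral_distr flip: nn_integral_indicator)
      finally show ?thesis .
    qed
    finally show "emeasure (distr Q borel D) B * emeasure \<rho> A =
      emeasure (distr Q (borel \<Otimes>\<^sub>M borel) (\<lambda>z. (D z, m z))) (B \<times> A)"
      using A by simp
  qed (simp_all add: DQ.sigma_finite_measure_axioms \<rho>.sigma_finite_measure_axioms S
      cong: sets_pair_measure_cong)
  then show ?thesis
    by (simp add: Q_def D_def m_def case_prod_beta')
qed

text \<open>Write \<open>D = X - Y\<close>.  Then \<open>X = max D 0 + min X Y\<close> and \<open>Y = max (- D) 0 + min X Y\<close>, where
  \<open>min X Y\<close> is independent of \<open>D\<close> and distributed as \<open>W\<close>.  Putting \<open>W\<close> in the place of the minimum
  therefore reproduces the joint law of \<open>X\<close> and \<open>Y\<close>.\<close>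

lemma distr_corner_flip:
  assumes P: "prob_space \<mu>" "prob_space \<nu>" "prob_space \<rho>"
    and S: "sets \<mu> = sets borel" "sets \<nu> = sets borel" "sets \<rho> = sets borel"
    and ml: "\<And>s. \<exists>d c c'. memoryless_at \<mu> s d c \<and> memoryless_at \<nu> s d c' \<and> emeasure \<rho> {s..} = c * c'"
  shows "distr ((\<mu> \<Otimes>\<^sub>M \<nu>) \<Otimes>\<^sub>M \<rho>) (borel \<Otimes>\<^sub>M borel)
    (\<lambda>((x, y), w). (max (x - y) 0 + w, max (y - x) 0 + w)) = \<mu> \<Otimes>\<^sub>M \<nu>"
proof -
  interpret \<mu>: prob_space \<mu> by fact
  interpret \<nu>: prob_space \<nu> by fact
  interpret \<rho>: prob_space \<rho> by fact
  interpret PP: pair_prob_space \<mu> \<nu> ..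
  note [measurable_cong] = S
  let ?D = "\<lambda>z::real \<times> real. fst z - snd z"
  let ?DW = "\<lambda>v::(real \<times> real) \<times> real. (fst (fst v) - snd (fst v), snd v)"
  let ?DM = "\<lambda>z::real \<times> real. (fst z - snd z, min (fst z) (snd z))"
  let ?G = "\<lambda>u::real \<times> real. (max (fst u) 0 + snd u, max (- fst u) 0 + snd u)"
  have [measurable]: "?D \<in> \<mu> \<Otimes>\<^sub>M \<nu> \<rightarrow>\<^sub>M borel"
    "?DW \<in> (\<mu> \<Otimes>\<^sub>M \<nu>) \<Otimes>\<^sub>M \<rho> \<rightarrow>\<^sub>M borel \<Otimes>\<^sub>M borel"
    "?DM \<in> \<mu> \<Otimes>\<^sub>M \<nu> \<rightarrow>\<^sub>M borel \<Otimes>\<^sub>M borel"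
    "?G \<in> borel \<Otimes>\<^sub>M borel \<rightarrow>\<^sub>M borel \<Otimes>\<^sub>M borel"
    by measurable
  have \<rho>: "distr \<rho> borel (\<lambda>w. w) = \<rho>" by (rule distr_id2) (rule S(3)[symmetric])
  have "distr (\<mu> \<Otimes>\<^sub>M \<nu>) borel ?D \<Otimes>\<^sub>M distr \<rho> borel (\<lambda>w. w) =
      distr ((\<mu> \<Otimes>\<^sub>M \<nu>) \<Otimes>\<^sub>M \<rho>) (borel \<Otimes>\<^sub>M borel) (\<lambda>(z, w). (?D z, w))"
    by (rule pair_measure_distr) (use \<rho> \<rho>.sigma_finite_measure_axioms in auto)
  then have eq: "distr ((\<mu> \<Otimes>\<^sub>M \<nu>) \<Otimes>\<^sub>M \<rho>) (borel \<Otimes>\<^sub>M borel) ?DW =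
      distr (\<mu> \<Otimes>\<^sub>M \<nu>) (borel \<Otimes>\<^sub>M borel) ?DM"
    using distr_diff_min[OF P S ml] unfolding \<rho> case_prod_beta' by argo
  have "distr ((\<mu> \<Otimes>\<^sub>M \<nu>) \<Otimes>\<^sub>M \<rho>) (borel \<Otimes>\<^sub>M borel)
      (\<lambda>((x, y), w). (max (x - y) 0 + w, max (y - x) 0 + w)) =
      distr (distr ((\<mu> \<Otimes>\<^sub>M \<nu>) \<Otimes>\<^sub>M \<rho>) (borel \<Otimes>\<^sub>M borel) ?DW) (borel \<Otimes>\<^sub>M borel) ?G"
    by (subst distr_distr) (auto simp: comp_def case_prod_beta')
  also have "\<dots> = distr (\<mu> \<Otimes>\<^sub>M \<nu>) (borel \<Otimes>\<^sub>M borel) (?G \<circ> ?DM)"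
    unfolding eq by (subst distr_distr) auto
  also have "?G \<circ> ?DM = (\<lambda>z. z)"
    by (auto simp: fun_eq_iff)
  also have "distr (\<mu> \<Otimes>\<^sub>M \<nu>) (borel \<Otimes>\<^sub>M borel) (\<lambda>z. z) = \<mu> \<Otimes>\<^sub>M \<nu>"
    by (rule distr_id2) (intro sets_pair_measure_cong S[symmetric])
  finally show ?thesis .
qed

text \<open>The parameters of the two boundary weights combine to that of the bulk weight:
  \<open>(a m + z) + (b n - z) = a m + b n\<close>, respectively \<open>(a m / z) * (b n * z) = a m * b n\<close>.  In both
  models the residual time \<open>d\<close> depends on \<open>s\<close> only, so it is common to the two laws.\<close>

lemma weight_law_memoryless:
  assumes "admissible_env M \<mu> a b" "admissible_z M \<mu> z" "m \<ge> 1" "n \<ge> 1"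
  shows "\<exists>d c c'. memoryless_at (weight_law M a b z (m, 0)) s d c \<and>
    memoryless_at (weight_law M a b z (0, n)) s d c' \<and>
    emeasure (weight_law M a b z (m, n)) {s..} = c * c'"
proof (cases M)
  case Exponential
  note adm = admissible_exponential[OF assms[unfolded Exponential]]
  have "emeasure (exp_law (a m + b n)) {s..} = ennreal (exp (- (a m + b n) * max s 0))"
    using memoryless_at_tail[OF memoryless_at_exp_law[OF adm(1), of s]] exp_law_tail(1)[OF adm(1), of 0]
    by (simp add: exp_law_def)
  also have "\<dots> = ennreal (exp (- (a m + z) * max s 0)) * ennreal (exp (- (b n - z) * max s 0))"
    by (simp add: algebra_simps flip: ennreal_mult exp_add)
  finally show ?thesis
    using assms(3,4) memoryless_at_exp_law[OF adm(2), of s] memoryless_at_exp_law[OF adm(3), of s]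
    by (auto simp: Exponential)
next
  case Geometric
  note adm = admissible_geometric[OF assms[unfolded Geometric]]
  have "emeasure (geom_law (a m * b n)) {s..} = ennreal ((a m * b n) ^ nat \<lceil>s\<rceil>)"
    using memoryless_at_tail[OF memoryless_at_geom_law[of "a m * b n" s]] geom_law_tail(1)[of "a m * b n"] adm(1)
    by (simp add: geom_law_def)
  also have "\<dots> = ennreal ((a m / z) ^ nat \<lceil>s\<rceil> * (b n * z) ^ nat \<lceil>s\<rceil>)"
    using adm(4) by (simp flip: power_mult_distrib)
  also have "\<dots> = ennreal ((a m / z) ^ nat \<lceil>s\<rceil>) * ennreal ((b n * z) ^ nat \<lceil>s\<rceil>)"
    using adm(2,3) by (intro ennreal_mult zero_le_power) auto
  finally show ?thesis
    using assms(3,4) memoryless_at_geom_law[of "a m / z" s] memoryless_at_geom_law[of "b n * z" s] adm(2,3)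
    by (auto simp: Geometric)
qed

section \<open>Replacing variables in an independent family\<close>

context prob_space
begin

text \<open>The product formula without the proviso that the finite index set be nonempty, so that index sets
  can be intersected freely.\<close>

lemma indep_vars_iff_prob:
  "indep_vars M' X I \<longleftrightarrow> (\<forall>i\<in>I. random_variable (M' i) (X i)) \<and>
    (\<forall>J A. J \<subseteq> I \<longrightarrow> finite J \<longrightarrow> (\<forall>j\<in>J. A j \<in> sets (M' j)) \<longrightarrow>
       prob {\<omega>\<in>space M. \<forall>j\<in>J. X j \<omega> \<in> A j} = (\<Prod>j\<in>J. prob (X j -` A j \<inter> space M)))"
  (is "_ \<longleftrightarrow> ?rv \<and> ?P")
proof
  assume ind: "indep_vars M' X I"
  have "prob {\<omega>\<in>space M. \<forall>j\<in>J. X j \<omega> \<in> A j} = (\<Prod>j\<in>J. prob (X j -` A j \<inter> space M))"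
    if J: "J \<subseteq> I" "finite J" "\<forall>j\<in>J. A j \<in> sets (M' j)" for J A
  proof (cases "J = {}")
    case True
    then show ?thesis by (simp add: prob_space)
  next
    case False
    then have "{\<omega>\<in>space M. \<forall>j\<in>J. X j \<omega> \<in> A j} = (\<Inter>j\<in>J. X j -` A j \<inter> space M)" by auto
    with False show ?thesis using indep_varsD[OF ind, of J A] J by simp
  qed
  then show "?rv \<and> ?P" using ind by (auto simp: indep_vars_def)
next
  assume R: "?rv \<and> ?P"
  have "indep_sets (\<lambda>i. {X i -` A \<inter> space M |A. A \<in> sets (M' i)}) I"
  proof (rule indep_setsI)
    fix i assume "i \<in> I"
    then show "{X i -` A \<inter> space M |A. A \<in> sets (M' i)} \<subseteq> events"
      using R by (auto intro: measurable_sets)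
  next
    fix E J assume J: "J \<noteq> {}" "J \<subseteq> I" "finite J"
      and "\<forall>j\<in>J. E j \<in> {X j -` A \<inter> space M |A. A \<in> sets (M' j)}"
    then obtain A where A: "\<And>j. j \<in> J \<Longrightarrow> A j \<in> sets (M' j)" "\<And>j. j \<in> J \<Longrightarrow> E j = X j -` A j \<inter> space M"
      by (auto simp: Ball_def) metis
    then have "(\<Inter>j\<in>J. E j) = {\<omega>\<in>space M. \<forall>j\<in>J. X j \<omega> \<in> A j}" using J(1) by auto
    then show "prob (\<Inter>j\<in>J. E j) = (\<Prod>j\<in>J. prob (E j))"
      using R J A by simp
  qed
  then show "indep_vars M' X I" using R by (simp add: indep_vars_def2)
qed

lemma indep_vars_finite_subfamilies:
  assumes "\<And>J. J \<subseteq> I \<Longrightarrow> finite J \<Longrightarrow> indep_vars M' X J"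
  shows "indep_vars M' X I"
  unfolding indep_vars_iff_prob
proof (intro conjI ballI allI impI)
  fix i assume "i \<in> I"
  then show "random_variable (M' i) (X i)"
    using assms[of "{i}"] by (simp add: indep_vars_iff_prob)
next
  fix J A assume "J \<subseteq> I" "finite J" "\<forall>j\<in>J. A j \<in> sets (M' j)"
  then show "prob {\<omega>\<in>space M. \<forall>j\<in>J. X j \<omega> \<in> A j} = (\<Prod>j\<in>J. prob (X j -` A j \<inter> space M))"
    using assms[of J] unfolding indep_vars_iff_prob by blast
qed

lemma indep_vars_reindex:
  assumes "indep_vars M' X I" "inj_on h L" "h ` L \<subseteq> I"
  shows "indep_vars (\<lambda>i. M' (h i)) (\<lambda>i. X (h i)) L"
proof -
  have "indep_vars (\<lambda>i. PiM {h i} M') (\<lambda>i \<omega>. restrict (\<lambda>j. X j \<omega>) {h i}) L"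
    using assms by (intro indep_vars_restrict) (auto simp: disjoint_family_on_def inj_on_def)
  then have "indep_vars (\<lambda>i. M' (h i)) (\<lambda>i \<omega>. (\<lambda>f. f (h i)) (restrict (\<lambda>j. X j \<omega>) {h i})) L"
    by (rule indep_vars_compose2) simp
  then show ?thesis by simp
qed

lemma indep_vars_Un:
  assumes A: "indep_vars M' X A" and B: "indep_vars M' X B" and "A \<inter> B = {}"
    and AB: "indep_var (PiM A M') (\<lambda>\<omega>. restrict (\<lambda>i. X i \<omega>) A) (PiM B M') (\<lambda>\<omega>. restrict (\<lambda>i. X i \<omega>) B)"
  shows "indep_vars M' X (A \<union> B)"
  unfolding indep_vars_iff_prob
proof (intro conjI ballI allI impI)
  fix i assume "i \<in> A \<union> B"
  then show "random_variable (M' i) (X i)" using A B by (auto simp: indep_vars_iff_prob)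
next
  fix J S assume J: "J \<subseteq> A \<union> B" "finite J" and S: "\<forall>j\<in>J. S j \<in> sets (M' j)"
  define box where "box C = {f\<in>space (PiM C M'). \<forall>j\<in>J \<inter> C. f j \<in> S j}" for C
  have box: "box C \<in> sets (PiM C M')" for C
  proof -
    have "Measurable.pred (PiM C M') (\<lambda>f. \<forall>j\<in>J \<inter> C. f j \<in> S j)"
      using J(2) S by (intro pred_intros_finite) (auto intro!: measurable_compose[OF measurable_component_singleton] pred_sets2)
    then show ?thesis by (simp add: box_def pred_def)
  qed
  have rvA: "\<And>\<omega>. \<omega> \<in> space M \<Longrightarrow> restrict (\<lambda>i. X i \<omega>) A \<in> space (PiM A M')"
    using A by (auto simp: space_PiM indep_vars_def dest: measurable_space)
  have rvB: "\<And>\<omega>. \<omega> \<in> space M \<Longrightarrow> restrict (\<lambda>i. X i \<omega>) B \<in> space (PiM B M')"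
    using B by (auto simp: space_PiM indep_vars_def dest: measurable_space)
  let ?E = "\<lambda>K. {\<omega>\<in>space M. \<forall>j\<in>K. X j \<omega> \<in> S j}"
  have "?E J = (\<lambda>\<omega>. (restrict (\<lambda>i. X i \<omega>) A, restrict (\<lambda>i. X i \<omega>) B)) -` (box A \<times> box B) \<inter> space M"
    using J(1) rvA rvB by (auto simp: box_def)
  then have "prob (?E J) = prob ((\<lambda>\<omega>. restrict (\<lambda>i. X i \<omega>) A) -` box A \<inter> space M) *
      prob ((\<lambda>\<omega>. restrict (\<lambda>i. X i \<omega>) B) -` box B \<inter> space M)"
    using indep_varD[OF AB box box] by simp
  also have "(\<lambda>\<omega>. restrict (\<lambda>i. X i \<omega>) A) -` box A \<inter> space M = ?E (J \<inter> A)"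
    using rvA by (auto simp: box_def)
  also have "(\<lambda>\<omega>. restrict (\<lambda>i. X i \<omega>) B) -` box B \<inter> space M = ?E (J \<inter> B)"
    using rvB by (auto simp: box_def)
  also have "prob (?E (J \<inter> A)) = (\<Prod>j\<in>J \<inter> A. prob (X j -` S j \<inter> space M))"
    using A J(2) S by (subst (asm) indep_vars_iff_prob) auto
  also have "prob (?E (J \<inter> B)) = (\<Prod>j\<in>J \<inter> B. prob (X j -` S j \<inter> space M))"
    using B J(2) S by (subst (asm) indep_vars_iff_prob) auto
  also have "(\<Prod>j\<in>J \<inter> A. prob (X j -` S j \<inter> space M)) * (\<Prod>j\<in>J \<inter> B. prob (X j -` S j \<inter> space M)) =
      (\<Prod>j\<in>(J \<inter> A) \<union> (J \<inter> B). prob (X j -` S j \<inter> space M))"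
    using J(2) assms(3) by (subst prod.union_disjoint) auto
  also have "(J \<inter> A) \<union> (J \<inter> B) = J" using J(1) by auto
  finally show "prob (?E J) = (\<Prod>j\<in>J. prob (X j -` S j \<inter> space M))" .
qed

lemma indep_vars_pair:
  assumes "indep_var N (X m) N (X n)" "m \<noteq> n"
  shows "indep_vars (\<lambda>_. N) X {m, n}"
proof -
  have rv: "random_variable N (X m)" "random_variable N (X n)"
    using assms(1) by (blast dest: indep_var_rv1 indep_var_rv2)+
  have single: "indep_vars (\<lambda>_. N) X {i}" if "random_variable N (X i)" for i
    using that by (auto simp: indep_vars_iff_prob subset_singleton_iff prob_space
        intro!: arg_cong[where f = prob])
  have "indep_var (PiM {m} (\<lambda>_. N)) ((\<lambda>x. \<lambda>i\<in>{m}. x) \<circ> X m) (PiM {n} (\<lambda>_. N)) ((\<lambda>x. \<lambda>i\<in>{n}. x) \<circ> X n)"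
    by (rule indep_var_compose[OF assms(1)]) (auto intro!: measurable_restrict)
  moreover have "(\<lambda>x. \<lambda>i\<in>{j}. x) \<circ> X j = (\<lambda>\<omega>. \<lambda>i\<in>{j}. X i \<omega>)" for j by (auto simp: fun_eq_iff)
  ultimately have ind: "indep_var (PiM {m} (\<lambda>_. N)) (\<lambda>\<omega>. \<lambda>i\<in>{m}. X i \<omega>)
      (PiM {n} (\<lambda>_. N)) (\<lambda>\<omega>. \<lambda>i\<in>{n}. X i \<omega>)"
    by (simp only:)
  have "indep_vars (\<lambda>_. N) X ({m} \<union> {n})"
    by (rule indep_vars_Un[OF single[OF rv(1)] single[OF rv(2)] _ ind]) (use assms(2) in auto)
  then show ?thesis by (simp add: insert_commute)
qed

text \<open>One step of the induction over lattice paths: in an independent family, the variables at \<open>m\<close>,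
  \<open>n\<close> and \<open>c\<close> are consumed and two new ones are put at \<open>m\<close> and \<open>n\<close>.  If the map \<open>F\<close> that produces them sends
  the product law of the three to the product law of the old pair, independence and marginal laws
  survive, because the new pair depends on the consumed block alone.\<close>

lemma indep_vars_replace_pair:
  fixes X Y :: "'i \<Rightarrow> 'a \<Rightarrow> 'b"
  assumes X: "indep_vars (\<lambda>_. N) X K"
    and K: "m \<in> K" "n \<in> K" "c \<in> K" "m \<noteq> n" "c \<noteq> m" "c \<noteq> n"
    and F: "F \<in> (N \<Otimes>\<^sub>M N) \<Otimes>\<^sub>M N \<rightarrow>\<^sub>M N \<Otimes>\<^sub>M N"
    and law: "distr ((distr M N (X m) \<Otimes>\<^sub>M distr M N (X n)) \<Otimes>\<^sub>M distr M N (X c)) (N \<Otimes>\<^sub>M N) F =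
      distr M N (X m) \<Otimes>\<^sub>M distr M N (X n)"
    and Y: "\<And>\<omega>. (Y m \<omega>, Y n \<omega>) = F ((X m \<omega>, X n \<omega>), X c \<omega>)"
    and rest: "\<And>i. i \<in> K - {m, n, c} \<Longrightarrow> Y i = X i"
  shows "indep_vars (\<lambda>_. N) Y (K - {c})"
    and "distr M N (Y m) = distr M N (X m)" "distr M N (Y n) = distr M N (X n)"
proof -
  note [measurable] = F
  have rv[measurable]: "random_variable N (X i)" if "i \<in> K" for i
    using X that by (auto simp: indep_vars_def)
  note [measurable] = rv[OF K(1)] rv[OF K(2)] rv[OF K(3)]
  define R where "R = K - {m, n, c}"
  let ?T = "\<lambda>\<omega>. ((X m \<omega>, X n \<omega>), X c \<omega>)"

  have "indep_var N ((\<lambda>f. f m) \<circ> (\<lambda>\<omega>. \<lambda>i\<in>{m}. X i \<omega>)) N ((\<lambda>f. f n) \<circ> (\<lambda>\<omega>. \<lambda>i\<in>{n}. X i \<omega>))"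
    using K by (intro indep_var_compose[OF indep_var_restrict[OF X]]) auto
  then have "indep_var N (X m) N (X n)" by (simp add: comp_def)
  then have mn: "distr M (N \<Otimes>\<^sub>M N) (\<lambda>\<omega>. (X m \<omega>, X n \<omega>)) = distr M N (X m) \<Otimes>\<^sub>M distr M N (X n)"
    by (simp add: indep_var_distribution_eq)
  have T: "distr M ((N \<Otimes>\<^sub>M N) \<Otimes>\<^sub>M N) ?T =
      (distr M N (X m) \<Otimes>\<^sub>M distr M N (X n)) \<Otimes>\<^sub>M distr M N (X c)"
  proof -
    \<comment> \<open>\<^const>\<open>indep_var\<close> needs two variables with values in a common type, hence the detour through
      restrictions to \<open>{m, n}\<close> and \<open>{c}\<close>.\<close>
    let ?Xmn = "\<lambda>\<omega>. \<lambda>i\<in>{m, n}. X i \<omega>" and ?Xc = "\<lambda>\<omega>. \<lambda>i\<in>{c}. X i \<omega>"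
    let ?A = "PiM {m, n} (\<lambda>_. N)" and ?B = "PiM {c} (\<lambda>_. N)"
    have [measurable]: "?Xmn \<in> M \<rightarrow>\<^sub>M ?A" "?Xc \<in> M \<rightarrow>\<^sub>M ?B"
      using K by (auto intro!: measurable_restrict)
    have [measurable]: "(\<lambda>f. (f m, f n)) \<in> ?A \<rightarrow>\<^sub>M N \<Otimes>\<^sub>M N" "(\<lambda>f. f c) \<in> ?B \<rightarrow>\<^sub>M N"
      by auto
    have eq: "distr M (N \<Otimes>\<^sub>M N) (\<lambda>\<omega>. (X m \<omega>, X n \<omega>)) = distr (distr M ?A ?Xmn) (N \<Otimes>\<^sub>M N) (\<lambda>f. (f m, f n))"
      "distr M N (X c) = distr (distr M ?B ?Xc) N (\<lambda>f. f c)"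
      by (subst distr_distr; simp add: comp_def)+
    have "indep_var ?A ?Xmn ?B ?Xc"
      using K by (intro indep_var_restrict[OF X]) auto
    then have AB: "distr M ?A ?Xmn \<Otimes>\<^sub>M distr M ?B ?Xc = distr M (?A \<Otimes>\<^sub>M ?B) (\<lambda>\<omega>. (?Xmn \<omega>, ?Xc \<omega>))"
      by (simp add: indep_var_distribution_eq)
    have "(distr M N (X m) \<Otimes>\<^sub>M distr M N (X n)) \<Otimes>\<^sub>M distr M N (X c) =
        distr (distr M ?A ?Xmn \<Otimes>\<^sub>M distr M ?B ?Xc) ((N \<Otimes>\<^sub>M N) \<Otimes>\<^sub>M N) (\<lambda>(f, g). ((f m, f n), g c))"
      unfolding mn[symmetric] eq
    proof (rule pair_measure_distr)
      have "prob_space (distr M N (X c))" by (rule prob_space_distr) simp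
      then show "sigma_finite_measure (distr (distr M ?B ?Xc) N (\<lambda>f. f c))"
        unfolding eq(2)[symmetric] by (rule prob_space_imp_sigma_finite)
    qed auto
    also have "\<dots> = distr M ((N \<Otimes>\<^sub>M N) \<Otimes>\<^sub>M N) ?T"
      unfolding AB by (subst distr_distr) (auto simp: comp_def)
    finally show ?thesis by (rule sym)
  qed

  have Yeq: "(\<lambda>\<omega>. (Y m \<omega>, Y n \<omega>)) = F \<circ> ?T" using Y by (auto simp: fun_eq_iff)
  have YF: "Y m = (\<lambda>\<omega>. fst (F (?T \<omega>)))" "Y n = (\<lambda>\<omega>. snd (F (?T \<omega>)))"
    using Y by (auto simp: fun_eq_iff simp flip: Y)
  have rvY[measurable]: "random_variable N (Y m)" "random_variable N (Y n)"
    unfolding YF by measurable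
  have "distr M (N \<Otimes>\<^sub>M N) (\<lambda>\<omega>. (Y m \<omega>, Y n \<omega>)) = distr (distr M ((N \<Otimes>\<^sub>M N) \<Otimes>\<^sub>M N) ?T) (N \<Otimes>\<^sub>M N) F"
    unfolding Yeq by (subst distr_distr) auto
  then have Ymn: "distr M (N \<Otimes>\<^sub>M N) (\<lambda>\<omega>. (Y m \<omega>, Y n \<omega>)) = distr M N (X m) \<Otimes>\<^sub>M distr M N (X n)"
    unfolding T law .
  interpret m: prob_space "distr M N (X m)" by (rule prob_space_distr) simp
  interpret n: prob_space "distr M N (X n)" by (rule prob_space_distr) simp
  interpret mn: pair_prob_space "distr M N (X m)" "distr M N (X n)" ..
  have "distr M N (Y m) = distr (distr M (N \<Otimes>\<^sub>M N) (\<lambda>\<omega>. (Y m \<omega>, Y n \<omega>))) N fst"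
    by (subst distr_distr) (auto simp: comp_def)
  also have "\<dots> = distr M N (X m)"
    unfolding Ymn using n.distr_pair_fst[of "distr M N (X m)"]
    by (simp cong: distr_cong)
  finally show Ym: "distr M N (Y m) = distr M N (X m)" .
  have "distr M N (Y n) = distr (distr M (N \<Otimes>\<^sub>M N) (\<lambda>\<omega>. (Y m \<omega>, Y n \<omega>))) N snd"
    by (subst distr_distr) (auto simp: comp_def)
  also have "\<dots> = distr M N (X n)"
    unfolding Ymn
  proof (rule measure_eqI)
    fix A assume "A \<in> sets (distr (distr M N (X m) \<Otimes>\<^sub>M distr M N (X n)) N snd)"
    then have A[measurable]: "A \<in> sets N" by simp
    have "snd -` A \<inter> space (distr M N (X m) \<Otimes>\<^sub>M distr M N (X n)) = space N \<times> A"
      using sets.sets_into_space[OF A] by (auto simp: space_pair_measure)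
    then show "emeasure (distr (distr M N (X m) \<Otimes>\<^sub>M distr M N (X n)) N snd) A = emeasure (distr M N (X n)) A"
      using m.emeasure_space_1
      by (simp add: emeasure_distr[of snd] n.emeasure_pair_measure_Times)
  qed simp
  finally show Yn: "distr M N (Y n) = distr M N (X n)" .

  have "indep_var N (Y m) N (Y n)"
    by (simp add: indep_var_distribution_eq Ymn Ym Yn)
  then have Y2: "indep_vars (\<lambda>_. N) Y {m, n}"
    using K(4) by (rule indep_vars_pair)
  have "indep_vars (\<lambda>_. N) X R"
    using X by (rule indep_vars_subset) (auto simp: R_def)
  then have YR: "indep_vars (\<lambda>_. N) Y R"
    by (subst indep_vars_cong[where Y = X]) (auto simp: R_def rest)
  let ?H = "\<lambda>f. \<lambda>i\<in>{m, n}. if i = m then fst (F ((f m, f n), f c)) else snd (F ((f m, f n), f c))"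
  have "indep_var (PiM {m, n} (\<lambda>_. N)) (?H \<circ> (\<lambda>\<omega>. \<lambda>i\<in>{m, n, c}. X i \<omega>))
      (PiM R (\<lambda>_. N)) ((\<lambda>f. f) \<circ> (\<lambda>\<omega>. \<lambda>i\<in>R. X i \<omega>))"
  proof (rule indep_var_compose[OF indep_var_restrict[OF X]])
    show "?H \<in> PiM {m, n, c} (\<lambda>_. N) \<rightarrow>\<^sub>M PiM {m, n} (\<lambda>_. N)"
      by (rule measurable_restrict) auto
  qed (use K in \<open>auto simp: R_def\<close>)
  moreover have "?H \<circ> (\<lambda>\<omega>. \<lambda>i\<in>{m, n, c}. X i \<omega>) = (\<lambda>\<omega>. \<lambda>i\<in>{m, n}. Y i \<omega>)"
    using K(4) by (auto simp: fun_eq_iff YF)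
  moreover have "(\<lambda>f. f) \<circ> (\<lambda>\<omega>. \<lambda>i\<in>R. X i \<omega>) = (\<lambda>\<omega>. \<lambda>i\<in>R. Y i \<omega>)"
    by (auto simp: fun_eq_iff rest R_def restrict_def)
  ultimately have "indep_var (PiM {m, n} (\<lambda>_. N)) (\<lambda>\<omega>. \<lambda>i\<in>{m, n}. Y i \<omega>)
      (PiM R (\<lambda>_. N)) (\<lambda>\<omega>. \<lambda>i\<in>R. Y i \<omega>)"
    by (simp only:)
  then have "indep_vars (\<lambda>_. N) Y ({m, n} \<union> R)"
    by (intro indep_vars_Un Y2 YR) (auto simp: R_def)
  also have "{m, n} \<union> R = K - {c}" using K by (auto simp: R_def)
  finally show "indep_vars (\<lambda>_. N) Y (K - {c})" .
qed

end

section \<open>Increments along the boundary of a Young diagram\<close>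

lemma incI_0: "i \<ge> 1 \<Longrightarrow> incI i 0 = weight i 0"
proof -
  assume "i \<ge> 1"
  then obtain i' where "i = Suc i'" by (cases i) auto
  moreover have "Ghat \<omega> i' 0 = (\<Sum>k=1..i'. weight k 0 \<omega>)" for \<omega> by (cases i') auto
  ultimately show ?thesis by (auto simp: incI_def fun_eq_iff)
qed

lemma incJ_0: "j \<ge> 1 \<Longrightarrow> incJ 0 j = weight 0 j"
proof -
  assume "j \<ge> 1"
  then obtain j' where "j = Suc j'" by (cases j) auto
  moreover have "Ghat \<omega> 0 j' = (\<Sum>k=1..j'. weight 0 k \<omega>)" for \<omega> by (cases j') auto
  ultimately show ?thesis by (auto simp: incJ_def fun_eq_iff)
qed

lemma incI_incJ_rec:
  assumes "m \<ge> 1" "n \<ge> 1"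
  shows "incI m n \<omega> = max (incI m (n - 1) \<omega> - incJ (m - 1) n \<omega>) 0 + weight m n \<omega>"
    and "incJ m n \<omega> = max (incJ (m - 1) n \<omega> - incI m (n - 1) \<omega>) 0 + weight m n \<omega>"
proof -
  obtain m' n' where "m = Suc m'" "n = Suc n'" using assms by (cases m; cases n) auto
  then show "incI m n \<omega> = max (incI m (n - 1) \<omega> - incJ (m - 1) n \<omega>) 0 + weight m n \<omega>"
    "incJ m n \<omega> = max (incJ (m - 1) n \<omega> - incI m (n - 1) \<omega>) 0 + weight m n \<omega>"
    by (auto simp: incI_def incJ_def max_def)
qed

text \<open>After the cells of a finite Young diagram \<open>A\<close> have been processed, the relevant variables are the
  increments along its boundary path and the weights of the remaining cells.  The path has exactly
  one horizontal edge in each column and one vertical edge in each row, so \<open>(i, 0)\<close> can index the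
  horizontal edge in column \<open>i\<close>, at the height of that column of \<open>A\<close>, and \<open>(0, j)\<close> the vertical
  edge in row \<open>j\<close>, at the length of that row.  With this indexing the law at each index does not depend on \<open>A\<close>.\<close>

fun interface :: "(nat \<times> nat) set \<Rightarrow> nat \<times> nat \<Rightarrow> (nat \<times> nat \<Rightarrow> real) \<Rightarrow> real" where
  "interface A (i, j) =
     (if j = 0 then incI i (card {j. (i, j) \<in> A})
      else if i = 0 then incJ (card {i. (i, j) \<in> A}) j
      else weight i j)"

definition young_diagram :: "(nat \<times> nat) set \<Rightarrow> bool" where
  "young_diagram A \<longleftrightarrow> finite A \<and> A \<subseteq> {1..} \<times> {1..} \<and>
     (\<forall>i j i' j'. (i, j) \<in> A \<longrightarrow> i' \<in> {1..i} \<longrightarrow> j' \<in> {1..j} \<longrightarrow> (i', j') \<in> A)"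

text \<open>A cell with maximal coordinate sum is a corner: nothing lies above it in its column or to the right
  of it in its row.\<close>

lemma young_diagram_remove_corner:
  assumes A: "young_diagram A" "A \<noteq> {}"
  obtains m n where "(m, n) \<in> A" "m \<ge> 1" "n \<ge> 1" "young_diagram (A - {(m, n)})"
    "{j. (m, j) \<in> A} = {1..n}" "{i. (i, n) \<in> A} = {1..m}"
proof -
  have "finite A" using A by (simp add: young_diagram_def)
  then have fin: "finite ((\<lambda>q. fst q + snd q) ` A)" by simp
  have "Max ((\<lambda>q. fst q + snd q) ` A) \<in> (\<lambda>q. fst q + snd q) ` A"
    using fin A(2) by (intro Max_in) auto
  then obtain p where p: "p \<in> A" "Max ((\<lambda>q. fst q + snd q) ` A) = fst p + snd p" by blast
  obtain m n where mn: "p = (m, n)" by fastforce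
  have max: "i + j \<le> m + n" if "(i, j) \<in> A" for i j using Max_ge[OF fin imageI[OF that]] p(2) mn by simp
  have down: "(i', j') \<in> A" if "(i, j) \<in> A" "i' \<in> {1..i}" "j' \<in> {1..j}" for i j i' j'
    using A that unfolding young_diagram_def by blast
  have pos: "i \<ge> 1" "j \<ge> 1" if "(i, j) \<in> A" for i j
    using A(1) that by (auto simp: young_diagram_def)
  have in_A: "(m, n) \<in> A" using p mn by simp
  show ?thesis
  proof
    show "{j. (m, j) \<in> A} = {1..n}"
    proof (intro set_eqI iffI)
      show "j \<in> {1..n}" if "j \<in> {j. (m, j) \<in> A}" for j
        using that max[of m j] pos(2)[of m j] by simp
      show "j \<in> {j. (m, j) \<in> A}" if "j \<in> {1..n}" for j
        using down[OF in_A, of m j] that pos[OF in_A] by simp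
    qed
    show "{i. (i, n) \<in> A} = {1..m}"
    proof (intro set_eqI iffI)
      show "i \<in> {1..m}" if "i \<in> {i. (i, n) \<in> A}" for i
        using that max[of i n] pos(1)[of i n] by simp
      show "i \<in> {i. (i, n) \<in> A}" if "i \<in> {1..m}" for i
        using down[OF in_A, of i n] that pos[OF in_A] by simp
    qed
    show "young_diagram (A - {(m, n)})"
      unfolding young_diagram_def
    proof (intro conjI allI impI)
      fix i j i' j' assume *: "(i, j) \<in> A - {(m, n)}" "i' \<in> {1..i}" "j' \<in> {1..j}"
      then show "(i', j') \<in> A - {(m, n)}" using max[of i j] down[of i j i' j'] by auto
    qed (use A in \<open>auto simp: young_diagram_def\<close>)
  qed (use in_A pos in auto)
qed

text \<open>All weight laws are concentrated on \<open>{0..}\<close>, so the restriction in the product measure loses no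
  mass and can be undone.\<close>

lemma weights_indep_law:
  assumes adm: "admissible_env M \<mu> a b" "admissible_z M \<mu> z"
  defines "P \<equiv> boundary_measure M a b z"
  shows "prob_space.indep_vars P (\<lambda>_. borel) (\<lambda>p \<omega>. \<omega> p) (- {(0, 0)})"
    and "distr P borel (\<lambda>\<omega>. \<omega> p) = weight_law M a b z p"
proof -
  interpret P: prob_space P unfolding P_def by (rule prob_space_boundary_measure[OF adm])
  let ?L = "weight_law M a b z"
  let ?R = "\<lambda>p. restrict_space (?L p) {0..}"
  have S: "sets (?L p) = sets borel" for p by (rule weight_law_prob(3)[OF adm])
  interpret PR: product_prob_space ?R UNIV
    by (intro product_prob_spaceI prob_space_restrict_weight_law[OF adm])
  have comp: "distr P (?R p) (\<lambda>\<omega>. \<omega> p) = ?R p" for p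
    unfolding P_def boundary_measure_def by (rule PR.PiM_component) simp
  have rv: "(\<lambda>\<omega>. \<omega> p) \<in> P \<rightarrow>\<^sub>M ?R p" for p
    unfolding P_def boundary_measure_def by (rule measurable_component_singleton) simp
  have idm: "(\<lambda>x. x) \<in> ?R p \<rightarrow>\<^sub>M borel" for p
    by (rule measurable_restrict_space1) (rule measurable_ident_sets[OF S])
  have "P.indep_vars ?R (\<lambda>p \<omega>. \<omega> p) UNIV"
    by (subst P.indep_vars_iff_distr_eq_PiM')
       (auto intro: rv simp: comp restrict_def, simp add: P_def boundary_measure_def)
  then have "P.indep_vars (\<lambda>_. borel) (\<lambda>p \<omega>. \<omega> p) UNIV"
    by (rule P.indep_vars_compose2[where Y = "\<lambda>_ x. x"]) (rule idm)
  then show "P.indep_vars (\<lambda>_. borel) (\<lambda>p \<omega>. \<omega> p) (- {(0, 0)})"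
    by (rule P.indep_vars_subset) simp
  show "distr P borel (\<lambda>\<omega>. \<omega> p) = ?L p" for p
  proof -
    interpret L: prob_space "?L p" by (rule weight_law_prob(1)[OF adm])
    have ae: "AE x in ?L p. x \<in> {0..}"
      using weight_law_prob(2)[OF adm, of p] by (subst L.prob_eq_1[symmetric]) (auto simp: S)
    have "distr P borel (\<lambda>\<omega>. \<omega> p) = distr (distr P (?R p) (\<lambda>\<omega>. \<omega> p)) borel (\<lambda>x. x)"
      by (subst distr_distr[OF idm rv]) (simp add: comp_def)
    also have "\<dots> = ?L p"
      unfolding comp
    proof (rule measure_eqI)
      fix B assume "B \<in> sets (distr (?R p) borel (\<lambda>x. x))"
      then have B: "B \<in> sets borel" by simp
      have sp: "space (?L p) = UNIV" using sets_eq_imp_space_eq[OF S] by simp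
      have "emeasure (distr (?R p) borel (\<lambda>x. x)) B = emeasure (?R p) (B \<inter> {0..})"
        using B by (subst emeasure_distr[OF idm]) (auto simp: space_restrict_space sp)
      also have "\<dots> = emeasure (?L p) (B \<inter> {0..})"
        by (rule emeasure_restrict_space) (auto simp: S)
      also have "\<dots> = emeasure (?L p) B"
        using ae B by (intro emeasure_eq_AE) (auto simp: S)
      finally show "emeasure (distr (?R p) borel (\<lambda>x. x)) B = emeasure (?L p) B" .
    qed (simp add: S)
    finally show ?thesis .
  qed
qed

text \<open>Processing the corner \<open>(m, n)\<close> of the diagram flips one corner of the boundary path.  The increments
  at \<open>(m, 0)\<close> and \<open>(0, n)\<close> and the weight at \<open>(m, n)\<close> turn into the two increments on the other side
  of the cell, which are again independent with the same laws, and nothing else changes.  The index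
  \<open>(0, 0)\<close> belongs to no edge.\<close>

lemma interface_law:
  fixes a b :: "nat \<Rightarrow> real"
  assumes adm: "admissible_env M \<mu> a b" "admissible_z M \<mu> z" and "young_diagram A"
  defines "P \<equiv> boundary_measure M a b z"
  shows "prob_space.indep_vars P (\<lambda>_. borel) (interface A) (- A - {(0, 0)}) \<and>
    (\<forall>p\<in>- A - {(0, 0)}. distr P borel (interface A p) = weight_law M a b z p)"
proof -
  interpret P: prob_space P unfolding P_def by (rule prob_space_boundary_measure[OF adm])
  let ?L = "weight_law M a b z"
  have S: "sets (?L p) = sets borel" for p by (rule weight_law_prob(3)[OF adm])
  note PL = weight_law_prob(1)[OF adm]
  have "finite A" using assms(3) by (simp add: young_diagram_def)
  then show ?thesis using assms(3)
  proof (induction "card A" arbitrary: A)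
    case 0
    then have A: "A = {}" by simp
    note ind = weights_indep_law(1)[OF adm, folded P_def] and law = weights_indep_law(2)[OF adm, folded P_def]
    have I: "interface {} p = (\<lambda>\<omega>. \<omega> p)" if "p \<noteq> (0, 0)" for p
      using that by (cases p) (auto simp: incI_0 incJ_0 weight_def[abs_def])
    then have "P.indep_vars (\<lambda>_. borel) (interface {}) (- {(0, 0)})"
      using ind by (subst P.indep_vars_cong[where Y = "\<lambda>p \<omega>. \<omega> p"]) auto
    then show ?case using law I by (simp add: A Compl_eq_Diff_UNIV del: interface.simps)
  next
    case (Suc k)
    then obtain m n where mn: "(m, n) \<in> A" "m \<ge> 1" "n \<ge> 1" "young_diagram (A - {(m, n)})"
      and A: "{j. (m, j) \<in> A} = {1..n}" "{i. (i, n) \<in> A} = {1..m}"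
      using young_diagram_remove_corner[of A] by (metis card.empty nat.distinct(1))
    let ?A = "A - {(m, n)}" and ?K = "- (A - {(m, n)}) - {(0, 0)}"
    have IH: "P.indep_vars (\<lambda>_. borel) (interface ?A) ?K"
      "\<And>p. p \<in> ?K \<Longrightarrow> distr P borel (interface ?A p) = ?L p"
    proof -
      have "k = card ?A" "finite ?A" using Suc.hyps(2) Suc.prems(1) mn(1) by simp_all
      from Suc.hyps(1)[OF this mn(4)]
      show "P.indep_vars (\<lambda>_. borel) (interface ?A) ?K"
        "\<And>p. p \<in> ?K \<Longrightarrow> distr P borel (interface ?A p) = ?L p" by blast+
    qed
    have A': "{j. (m, j) \<in> ?A} = {1..n - 1}" "{i. (i, n) \<in> ?A} = {1..m - 1}"
    proof -
      have "{j. (m, j) \<in> ?A} = {j. (m, j) \<in> A} - {n}" by blast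
      also have "\<dots> = {1..n - 1}" unfolding A(1) using mn(3) by auto
      finally show "{j. (m, j) \<in> ?A} = {1..n - 1}" .
      have "{i. (i, n) \<in> ?A} = {i. (i, n) \<in> A} - {m}" by blast
      also have "\<dots> = {1..m - 1}" unfolding A(2) using mn(2) by auto
      finally show "{i. (i, n) \<in> ?A} = {1..m - 1}" .
    qed
    have axes: "(m, 0) \<in> ?K" "(0, n) \<in> ?K" "(m, n) \<in> ?K"
    proof -
      have "A \<subseteq> {1..} \<times> {1..}" using Suc.prems(2) by (simp add: young_diagram_def)
      then have "(m, 0) \<notin> A" "(0, n) \<notin> A" by auto
      then show "(m, 0) \<in> ?K" "(0, n) \<in> ?K" "(m, n) \<in> ?K" using mn(2,3) by auto
    qed
    define F :: "(real \<times> real) \<times> real \<Rightarrow> real \<times> real"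
      where "F = (\<lambda>((x, y), w). (max (x - y) 0 + w, max (y - x) 0 + w))"
    have F: "F \<in> (borel \<Otimes>\<^sub>M borel) \<Otimes>\<^sub>M borel \<rightarrow>\<^sub>M borel \<Otimes>\<^sub>M borel"
    proof -
      have "F = (\<lambda>v. (max (fst (fst v) - snd (fst v)) 0 + snd v,
          max (snd (fst v) - fst (fst v)) 0 + snd v))"
        by (auto simp: F_def)
      then show ?thesis by simp
    qed
    have flip: "distr ((distr P borel (interface ?A (m, 0)) \<Otimes>\<^sub>M distr P borel (interface ?A (0, n))) \<Otimes>\<^sub>M
          distr P borel (interface ?A (m, n))) (borel \<Otimes>\<^sub>M borel) F =
        distr P borel (interface ?A (m, 0)) \<Otimes>\<^sub>M distr P borel (interface ?A (0, n))"
      unfolding IH(2)[OF axes(1)] IH(2)[OF axes(2)] IH(2)[OF axes(3)] F_def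
      by (intro distr_corner_flip PL S weight_law_memoryless[OF adm mn(2,3)])
    have rec: "(interface A (m, 0) \<omega>, interface A (0, n) \<omega>) =
        F ((interface ?A (m, 0) \<omega>, interface ?A (0, n) \<omega>), interface ?A (m, n) \<omega>)" for \<omega>
      using mn(2,3) incI_incJ_rec[OF mn(2,3), of \<omega>] A A' by (simp add: F_def)
    have unchanged: "interface A p = interface ?A p" if "p \<noteq> (m, 0)" "p \<noteq> (0, n)" for p
    proof -
      obtain i j where p: "p = (i, j)" by fastforce
      have "{j'. (i, j') \<in> A} = {j'. (i, j') \<in> ?A}" if "i \<noteq> m" using that by auto
      moreover have "{i'. (i', j) \<in> A} = {i'. (i', j) \<in> ?A}" if "j \<noteq> n" using that by auto
      ultimately show ?thesis using that unfolding p interface.simps by auto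
    qed
    have "(m, 0) \<noteq> (0, n)" "(m, n) \<noteq> (m, 0)" "(m, n) \<noteq> (0, n)" using mn(2,3) by auto
    note step = P.indep_vars_replace_pair[OF IH(1) axes this F flip rec unchanged]
    have K: "?K - {(m, n)} = - A - {(0, 0)}" using mn(1) by auto
    have "P.indep_vars (\<lambda>_. borel) (interface A) (- A - {(0, 0)})"
      using step(1) unfolding K by blast
    moreover have "distr P borel (interface A p) = ?L p" if p: "p \<in> - A - {(0, 0)}" for p
    proof -
      consider "p = (m, 0)" | "p = (0, n)" | "p \<noteq> (m, 0)" "p \<noteq> (0, n)" by blast
      then show ?thesis
      proof cases
        case 1
        have "distr P borel (interface A (m, 0)) = distr P borel (interface ?A (m, 0))"
          by (rule step(2)) auto
        then show ?thesis using 1 IH(2)[OF axes(1)] by simp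
      next
        case 2
        have "distr P borel (interface A (0, n)) = distr P borel (interface ?A (0, n))"
          by (rule step(3)) auto
        then show ?thesis using 2 IH(2)[OF axes(2)] by simp
      next
        case 3
        then show ?thesis using IH(2)[of p] p unchanged by auto
      qed
    qed
    ultimately show ?case by blast
  qed
qed

theorem proposition4p1:
  fixes M :: model
    and \<mu> :: "((nat \<Rightarrow> real) \<times> (nat \<Rightarrow> real)) measure"
    and a b :: "nat \<Rightarrow> real"
    and z :: real
    and k l :: nat
  assumes "environment_law M \<mu>"
    and "admissible_env M \<mu> a b"
    and "admissible_z M \<mu> z"
  shows "(\<forall>i\<ge>1. distr (boundary_measure M a b z) borel (incI i l) =
                 distr (boundary_measure M a b z) borel (weight i 0)) \<and>
         (\<forall>j\<ge>1. distr (boundary_measure M a b z) borel (incJ k j) =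
                 distr (boundary_measure M a b z) borel (weight 0 j)) \<and>
         prob_space.indep_vars (boundary_measure M a b z) (\<lambda>_. borel)
           (case_sum (\<lambda>i. incI i l) (\<lambda>j. incJ k j)) ({k<..} <+> {l<..})"
proof -
  define P where "P = boundary_measure M a b z"
  interpret P: prob_space P unfolding P_def by (rule prob_space_boundary_measure[OF assms(2,3)])
  note IL = interface_law[OF assms(2,3), folded P_def]
  \<comment> \<open>Between heights \<open>N\<close> and \<open>l\<close> the boundary path of this diagram runs down from \<open>(k, N)\<close> to
    \<open>(k, l)\<close>, and from there along height \<open>l\<close> to \<open>(N, l)\<close>; truncation at \<open>N\<close> keeps the diagram
    finite.\<close>
  define hook where "hook k l N = {(i, j). i \<in> {1..N} \<and> j \<in> {1..N} \<and> (i \<le> k \<or> j \<le> l)}" for k l N :: nat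
  have young: "young_diagram (hook k l N)" for k l N
  proof -
    have "hook k l N \<subseteq> {1..N} \<times> {1..N}" by (auto simp: hook_def)
    then have "finite (hook k l N)" by (rule finite_subset) simp
    then show ?thesis unfolding young_diagram_def by (auto simp: hook_def)
  qed
  have hI: "interface (hook k l N) (i, 0) = incI i l" if "k < i" "i \<le> N" "l \<le> N" for i k l N
  proof -
    have "{j. (i, j) \<in> hook k l N} = {1..l}" using that by (auto simp: hook_def)
    then show ?thesis by simp
  qed
  have hJ: "interface (hook k l N) (0, j) = incJ k j" if "l < j" "j \<le> N" "k \<le> N" for j k l N
  proof -
    have "{i. (i, j) \<in> hook k l N} = {1..k}" using that by (auto simp: hook_def)
    then show ?thesis using that by simp
  qed
  have axis: "(i, 0) \<in> - hook k l N - {(0, 0)}" "(0, i) \<in> - hook k l N - {(0, 0)}" if "i \<ge> 1" for i k l N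
    using that by (auto simp: hook_def)

  note law = IL[OF young, THEN conjunct2, THEN bspec]
  have I: "distr P borel (incI i l) = weight_law M a b z (i, 0)" if "i \<ge> 1" for i l
    using law[OF axis(1)[OF that, of 0 l "max i l"]] hI[of 0 i "max i l" l] that
    by (simp del: interface.simps)
  have J: "distr P borel (incJ k j) = weight_law M a b z (0, j)" if "j \<ge> 1" for j k
    using law[OF axis(2)[OF that, of k 0 "max j k"]] hJ[of 0 j "max j k" k] that
    by (simp del: interface.simps)
  have "distr P borel (incI i l) = distr P borel (weight i 0)" if "i \<ge> 1" for i
    using I[OF that, of l] I[OF that, of 0] incI_0[OF that] by simp
  moreover have "distr P borel (incJ k j) = distr P borel (weight 0 j)" if "j \<ge> 1" for j
    using J[OF that, of k] J[OF that, of 0] incJ_0[OF that] by simp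
  moreover have "P.indep_vars (\<lambda>_. borel) (case_sum (\<lambda>i. incI i l) (\<lambda>j. incJ k j)) ({k<..} <+> {l<..})"
  proof (rule P.indep_vars_finite_subfamilies)
    fix J :: "(nat + nat) set" assume J: "J \<subseteq> {k<..} <+> {l<..}" "finite J"
    let ?pos = "case_sum (\<lambda>i. (i, 0)) (\<lambda>j. (0, j)) :: nat + nat \<Rightarrow> nat \<times> nat"
    define N where "N = k + l + (\<Sum>x\<in>J. case_sum id id x)"
    have N: "k \<le> N" "l \<le> N" "\<And>x. x \<in> J \<Longrightarrow> case_sum id id x \<le> N"
      using J(2) member_le_sum[of _ J "case_sum id id"] by (auto simp: N_def trans_le_add2)
    have "inj_on ?pos J" using J(1) by (auto simp: inj_on_def split: sum.splits)
    moreover have "?pos ` J \<subseteq> - hook k l N - {(0, 0)}"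
      using J(1) by (auto simp: hook_def)
    ultimately have "P.indep_vars (\<lambda>_. borel) (\<lambda>x. interface (hook k l N) (?pos x)) J"
      using IL[OF young, of k l N] P.indep_vars_reindex[of "\<lambda>_. borel"] by blast
    moreover have "interface (hook k l N) (?pos x) = case_sum (\<lambda>i. incI i l) (\<lambda>j. incJ k j) x" if "x \<in> J" for x
      using J(1) N(1,2) N(3)[OF that] that by (cases x) (auto simp: hI hJ simp del: interface.simps)
    ultimately show "P.indep_vars (\<lambda>_. borel) (case_sum (\<lambda>i. incI i l) (\<lambda>j. incJ k j)) J"
      by (subst P.indep_vars_cong[where Y = "\<lambda>x. interface (hook k l N) (?pos x)"]) auto
  qed
  ultimately show ?thesis unfolding P_def by blast
qed

end
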